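(* Let $R$ be an associative (not necessarily unital or commutative) $\mathbb{F}$-algebra with a homothetic datum $(\sigma,s)$, and let $R(\sigma,s)=R\oplus\mathbb{F}\boldsymbol{\sigma}$ be the corresponding homothetic extension. Let $\alpha_R:R\to R$ be an algebra endomorphism. Then there exists an algebra endomorphism $\alpha_S$ of $R(\sigma,s)$ extending $\alpha_R$, i.e. such that $\alpha_S\circ\iota=\iota\circ\alpha_R$, where $\iota:R\to R(\sigma,s)$, $a\mapsto a+0\boldsymbol{\sigma}$, if and only if there exist $w\in R$ and a scalar $\varsigma\in\mathbb{F}$ equal to either $0$ or $1$ such that, for all $a\in R$, (i) $\alpha_R(s)-\varsigma s = w^2+\varsigma\, w\sigma+\varsigma\,\sigma w-w$, (ii) $\alpha_R(a\sigma)=\varsigma\,\alpha_R(a)\sigma+\alpha_R(a)w$, (iii) $\alpha_R(\sigma a)=\varsigma\,\sigma\alpha_R(a)+w\alpha_R(a)$.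
   Context: $\mathbb{F}$ denotes a field or the ring of integers $\mathbb{Z}$. Algebras are associative $\mathbb{F}$-algebras, not necessarily unital or commutative; algebra endomorphisms are $\mathbb{F}$-linear multiplicative maps (no unitality required). A double operator $\sigma=(\overleftarrow{\sigma},\overrightarrow{\sigma})$ on $R$ is a pair of $\mathbb{F}$-linear endomorphisms of $R$, written $\overrightarrow{\sigma}(a)=\sigma a$ and $\overleftarrow{\sigma}(a)=a\sigma$. It is a bimultiplication if $\sigma(ab)=(\sigma a)b$, $(ab)\sigma=a(b\sigma)$ and $a(\sigma b)=(a\sigma)b$ for all $a,b\in R$. A bimultiplication is a double homothetism if $\sigma(a\sigma)=(\sigma a)\sigma$ for all $a\in R$. A homothetic datum on $R$ is a pair $(\sigma,s)$ with $\sigma$ a double homothetism and $s\in R$ such that $\sigma s=s\sigma$ and $\sigma^2=\sigma+\bar{s}$, i.e. $\sigma(\sigma a)=\sigma a+sa$ and $(a\sigma)\sigma=a\sigma+as$ for all $a\in R$. The homothetic extension $R(\sigma,s)$ is the $\mathbb{F}$-module $R\oplus\mathbb{F}$, whose elements $(a,\xi)$ are written $a+\xi\boldsymbol{\sigma}$, with the associative multiplication $$(a+\xi\boldsymbol{\sigma})(b+\zeta\boldsymbol{\sigma})=ab+\zeta\, a\sigma+\xi\,\sigma b+\xi\zeta s+\xi\zeta\boldsymbol{\sigma}.$$ *)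

theory Defs
  imports "HOL-Analysis.Product_Vector"
begin

text \<open>
  The ground ring is a field or (a copy of) the ring of integers; the only ring homomorphism
  from the integers into a unital ring is \<^const>\<open>of_int\<close>, so the second alternative says
  exactly that the ring is isomorphic to the integers.
\<close>

class field_or_int = comm_ring_1 +
  assumes field_or_int: "(\<forall>x. x \<noteq> 0 \<longrightarrow> (\<exists>y. x * y = 1)) \<or> bij (of_int :: int \<Rightarrow> 'a)"

subclass (in field) field_or_int
  by unfold_locales (use right_inverse in blast)

instance int :: field_or_int
  by standard (simp add: bij_def inj_def surj_def)

text \<open>
  The product is an explicit parameter, because that of a homothetic extension depends on a
  homothetic datum and so cannot be given by a type class instance.
\<close>

locale assoc_algebra = module smul
  for smul :: "'f::comm_ring_1 \<Rightarrow> 'r::ab_group_add \<Rightarrow> 'r" +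
  fixes mult :: "'r \<Rightarrow> 'r \<Rightarrow> 'r"
  assumes mult_assoc: "mult (mult a b) c = mult a (mult b c)"
    and mult_add_left: "mult (a + b) c = mult a c + mult b c"
    and mult_add_right: "mult a (b + c) = mult a b + mult a c"
    and mult_scale_left: "mult (smul \<xi> a) b = smul \<xi> (mult a b)"
    and mult_scale_right: "mult a (smul \<xi> b) = smul \<xi> (mult a b)"

definition algebra_endomorphism ::
  "('f::comm_ring_1 \<Rightarrow> 'r::ab_group_add \<Rightarrow> 'r) \<Rightarrow> ('r \<Rightarrow> 'r \<Rightarrow> 'r) \<Rightarrow> ('r \<Rightarrow> 'r) \<Rightarrow> bool" where
  "algebra_endomorphism smul mult \<alpha> \<longleftrightarrow>
     module_hom smul smul \<alpha> \<and> (\<forall>a b. \<alpha> (mult a b) = mult (\<alpha> a) (\<alpha> b))"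

text \<open>
  In a double operator \<open>\<sigma>\<close>, the first component is the right action \<open>a \<mapsto> a\<sigma>\<close> (left-pointing arrow)
  and the second one is the left action \<open>a \<mapsto> \<sigma>a\<close> (right-pointing arrow).
\<close>

type_synonym 'r double_op = "('r \<Rightarrow> 'r) \<times> ('r \<Rightarrow> 'r)"

definition ract :: "'r \<Rightarrow> 'r double_op \<Rightarrow> 'r"  (infixl "\<lhd>" 75)
  where "a \<lhd> \<sigma> = fst \<sigma> a"

definition lact :: "'r double_op \<Rightarrow> 'r \<Rightarrow> 'r"  (infixr "\<rhd>" 76)
  where "\<sigma> \<rhd> a = snd \<sigma> a"

definition double_operator ::
  "('f::comm_ring_1 \<Rightarrow> 'r::ab_group_add \<Rightarrow> 'r) \<Rightarrow> 'r double_op \<Rightarrow> bool" where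
  "double_operator smul \<sigma> \<longleftrightarrow>
     module_hom smul smul (\<lambda>a. a \<lhd> \<sigma>) \<and> module_hom smul smul (\<lambda>a. \<sigma> \<rhd> a)"

definition bimultiplication ::
  "('f::comm_ring_1 \<Rightarrow> 'r::ab_group_add \<Rightarrow> 'r) \<Rightarrow> ('r \<Rightarrow> 'r \<Rightarrow> 'r) \<Rightarrow> 'r double_op \<Rightarrow> bool" where
  "bimultiplication smul mult \<sigma> \<longleftrightarrow> double_operator smul \<sigma> \<and>
     (\<forall>a b. \<sigma> \<rhd> (mult a b) = mult (\<sigma> \<rhd> a) b \<and>
            (mult a b) \<lhd> \<sigma> = mult a (b \<lhd> \<sigma>) \<and>
            mult a (\<sigma> \<rhd> b) = mult (a \<lhd> \<sigma>) b)"

definition double_homothetism ::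
  "('f::comm_ring_1 \<Rightarrow> 'r::ab_group_add \<Rightarrow> 'r) \<Rightarrow> ('r \<Rightarrow> 'r \<Rightarrow> 'r) \<Rightarrow> 'r double_op \<Rightarrow> bool" where
  "double_homothetism smul mult \<sigma> \<longleftrightarrow> bimultiplication smul mult \<sigma> \<and>
     (\<forall>a. \<sigma> \<rhd> (a \<lhd> \<sigma>) = (\<sigma> \<rhd> a) \<lhd> \<sigma>)"

definition homothetic_datum ::
  "('f::comm_ring_1 \<Rightarrow> 'r::ab_group_add \<Rightarrow> 'r) \<Rightarrow> ('r \<Rightarrow> 'r \<Rightarrow> 'r) \<Rightarrow> 'r double_op \<Rightarrow> 'r \<Rightarrow> bool" where
  "homothetic_datum smul mult \<sigma> s \<longleftrightarrow> double_homothetism smul mult \<sigma> \<and>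
     \<sigma> \<rhd> s = s \<lhd> \<sigma> \<and>
     (\<forall>a. \<sigma> \<rhd> (\<sigma> \<rhd> a) = \<sigma> \<rhd> a + mult s a \<and>
          (a \<lhd> \<sigma>) \<lhd> \<sigma> = a \<lhd> \<sigma> + mult a s)"

text \<open>The pair \<open>(a, \<xi>)\<close> stands for the element \<open>a + \<xi>\<sigma>\<close> of the homothetic extension.\<close>

definition ext_scale ::
  "('f::comm_ring_1 \<Rightarrow> 'r::ab_group_add \<Rightarrow> 'r) \<Rightarrow> 'f \<Rightarrow> 'r \<times> 'f \<Rightarrow> 'r \<times> 'f" where
  "ext_scale smul = module_prod.scale smul (*)"

definition ext_mult ::
  "('f::comm_ring_1 \<Rightarrow> 'r::ab_group_add \<Rightarrow> 'r) \<Rightarrow> ('r \<Rightarrow> 'r \<Rightarrow> 'r) \<Rightarrow> 'r double_op \<Rightarrow> 'r \<Rightarrow>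
     'r \<times> 'f \<Rightarrow> 'r \<times> 'f \<Rightarrow> 'r \<times> 'f" where
  "ext_mult smul mult \<sigma> s = (\<lambda>(a, \<xi>) (b, \<zeta>).
     (mult a b + smul \<zeta> (a \<lhd> \<sigma>) + smul \<xi> (\<sigma> \<rhd> b) + smul (\<xi> * \<zeta>) s, \<xi> * \<zeta>))"

definition ext_incl :: "'r \<Rightarrow> 'r \<times> 'f::comm_ring_1" where
  "ext_incl a = (a, 0)"

lemma (in assoc_algebra) ext_scale_Pair: "ext_scale smul c (a, \<xi>) = (smul c a, c * \<xi>)"
proof -
  interpret m: module "(*) :: 'f \<Rightarrow> 'f \<Rightarrow> 'f"
    by unfold_locales (simp_all add: algebra_simps)
  interpret p: module_prod smul "(*) :: 'f \<Rightarrow> 'f \<Rightarrow> 'f" ..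
  show ?thesis
    by (simp add: ext_scale_def p.scale_prod)
qed

lemma (in assoc_algebra) assoc_algebra_ext:
  assumes "homothetic_datum smul mult \<sigma> s"
  shows "assoc_algebra (ext_scale smul) (ext_mult smul mult \<sigma> s)"
proof -
  interpret m: module "(*) :: 'f \<Rightarrow> 'f \<Rightarrow> 'f"
    by unfold_locales (simp_all add: algebra_simps)
  interpret p: module_prod smul "(*) :: 'f \<Rightarrow> 'f \<Rightarrow> 'f" ..
  have r: "module_hom smul smul (\<lambda>a. a \<lhd> \<sigma>)" and l: "module_hom smul smul (\<lambda>a. \<sigma> \<rhd> a)"
    and bm: "\<And>a b. \<sigma> \<rhd> (mult a b) = mult (\<sigma> \<rhd> a) b"
      "\<And>a b. (mult a b) \<lhd> \<sigma> = mult a (b \<lhd> \<sigma>)"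
      "\<And>a b. mult a (\<sigma> \<rhd> b) = mult (a \<lhd> \<sigma>) b"
    and dh: "\<And>a. \<sigma> \<rhd> (a \<lhd> \<sigma>) = (\<sigma> \<rhd> a) \<lhd> \<sigma>"
    and hd: "\<sigma> \<rhd> s = s \<lhd> \<sigma>" "\<And>a. \<sigma> \<rhd> (\<sigma> \<rhd> a) = \<sigma> \<rhd> a + mult s a"
      "\<And>a. (a \<lhd> \<sigma>) \<lhd> \<sigma> = a \<lhd> \<sigma> + mult a s"
    using assms
    by (auto simp: homothetic_datum_def double_homothetism_def bimultiplication_def
        double_operator_def)
  note lin = module_hom.add[OF r] module_hom.add[OF l] module_hom.scale[OF r] module_hom.scale[OF l]
  have "module (ext_scale smul :: 'f \<Rightarrow> 'r \<times> 'f \<Rightarrow> 'r \<times> 'f)"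
    unfolding ext_scale_def by (rule p.p.module_axioms)
  then show ?thesis
  proof (intro assoc_algebra.intro assoc_algebra_axioms.intro)
    note simps = ext_mult_def ext_scale_Pair mult_add_left mult_add_right
      mult_scale_left mult_scale_right lin scale_right_distrib scale_left_distrib
    fix x y z :: "'r \<times> 'f" and c :: 'f
    let ?m = "ext_mult smul mult \<sigma> s"
    obtain a \<xi> b \<zeta> d \<eta> where xyz: "x = (a, \<xi>)" "y = (b, \<zeta>)" "z = (d, \<eta>)"
      by (metis surj_pair)
    show "?m (?m x y) z = ?m x (?m y z)"
      by (simp add: xyz simps mult_assoc bm dh hd) (simp only: ac_simps)
    show "?m (x + y) z = ?m x z + ?m y z"
      by (simp add: xyz simps distrib_right)
    show "?m x (y + z) = ?m x y + ?m x z"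
      by (simp add: xyz simps distrib_left)
    show "?m (ext_scale smul c x) y = ext_scale smul c (?m x y)"
      by (simp add: xyz simps) (simp only: ac_simps)
    show "?m x (ext_scale smul c y) = ext_scale smul c (?m x y)"
      by (simp add: xyz simps) (simp only: ac_simps)
  qed
qed

end

theory Submission
  imports Defs
begin

text \<open>
  As a module, \<open>R(\<sigma>, s)\<close> is generated by \<open>R\<close> together with the single element \<open>\<sigma> = (0, 1)\<close>, so a
  linear extension of \<open>\<alpha>\<close> is the same thing as a choice of the image \<open>w + \<epsilon>\<sigma>\<close> of \<open>\<sigma>\<close>
  (\<open>linear_extension_eq_ext_lift\<close>, \<open>module_hom_ext_lift\<close>).  As an algebra, \<open>R(\<sigma>, s)\<close> is presented
  over \<open>R\<close> by the relations \<open>\<sigma>\<^sup>2 = s + \<sigma>\<close>, \<open>a \<cdot> \<sigma> = a\<sigma>\<close> and \<open>\<sigma> \<cdot> a = \<sigma>a\<close>, the right-hand sides of the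
  last two being elements of \<open>R\<close>.  Hence the extension is multiplicative exactly when \<open>w + \<epsilon>\<sigma>\<close>
  satisfies the images of these relations under \<open>\<alpha>\<close>
  (\<open>ext_lift_multiplicative_iff\<close>).  The two relations with \<open>a\<close> give the formulas for
  \<open>\<alpha>(a\<sigma>)\<close> and \<open>\<alpha>(\<sigma>a)\<close>.  The relation for \<open>\<sigma>\<^sup>2\<close> has an \<open>R\<close>-component, which gives the formula for
  \<open>\<alpha>(s) - \<epsilon>s\<close>, and a scalar component, \<open>\<epsilon>\<^sup>2 = \<epsilon>\<close>; over a field or the integers this says that \<open>\<epsilon>\<close> is \<open>0\<close> or \<open>1\<close>.
\<close>

lemma idempotent_iff_zero_or_one:
  fixes e :: "'f::field_or_int"
  shows "e * e = e \<longleftrightarrow> e = 0 \<or> e = 1"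
proof
  assume idem: "e * e = e"
  from field_or_int[where 'a='f] show "e = 0 \<or> e = 1"
  proof
    assume inv: "\<forall>x::'f. x \<noteq> 0 \<longrightarrow> (\<exists>y. x * y = 1)"
    show ?thesis
    proof (cases "e = 0")
      case False
      with inv obtain y where "e * y = 1" by blast
      then have "e = (e * e) * y" by (simp add: mult.assoc)
      also have "\<dots> = 1"
        using \<open>e * y = 1\<close> by (simp only: idem)
      finally show ?thesis ..
    qed simp
  next
    assume bij: "bij (of_int :: int \<Rightarrow> 'f)"
    then obtain k where k: "e = of_int k"
      by (metis bij_pointE)
    with idem have "(of_int (k * k) :: 'f) = of_int k" by simp
    then have "k * k = k"
      using bij by (simp only: bij_def inj_eq)
    then show ?thesis
      using k by auto
  qed
qed auto

lemma homothetic_datum_linear_actions: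
  assumes "homothetic_datum smul mult \<sigma> s"
  shows "module_hom smul smul (\<lambda>a. a \<lhd> \<sigma>)" and "module_hom smul smul (\<lambda>a. \<sigma> \<rhd> a)"
  using assms
  by (simp_all add: homothetic_datum_def double_homothetism_def bimultiplication_def
      double_operator_def)

context assoc_algebra
begin

lemma mult_zero_left: "mult 0 a = 0"
  using mult_scale_left[of 0 0 a] by simp

lemma mult_zero_right: "mult a 0 = 0"
  using mult_scale_right[of a 0 0] by simp

text \<open>The linear map that restricts to \<open>\<alpha>\<close> on \<open>R\<close> and sends \<open>\<sigma>\<close> to \<open>w + \<epsilon>\<sigma>\<close>.\<close>

definition ext_lift :: "('r \<Rightarrow> 'r) \<Rightarrow> 'r \<Rightarrow> 'f \<Rightarrow> 'r \<times> 'f \<Rightarrow> 'r \<times> 'f" where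
  "ext_lift \<alpha> w \<epsilon> = (\<lambda>(a, \<xi>). (\<alpha> a + smul \<xi> w, \<xi> * \<epsilon>))"

lemma ext_lift_Pair: "ext_lift \<alpha> w \<epsilon> (a, \<xi>) = (\<alpha> a + smul \<xi> w, \<xi> * \<epsilon>)"
  by (simp add: ext_lift_def)

lemma ext_lift_extends: "ext_lift \<alpha> w \<epsilon> \<circ> ext_incl = ext_incl \<circ> \<alpha>"
  by (simp add: fun_eq_iff ext_incl_def ext_lift_Pair)

lemma module_hom_ext_lift:
  assumes "module_hom smul smul \<alpha>"
  shows "module_hom (ext_scale smul) (ext_scale smul) (ext_lift \<alpha> w \<epsilon>)"
proof -
  interpret h: module_hom smul smul \<alpha> by fact
  have "module (ext_scale smul)"
    by (rule module.intro)
      (auto simp: ext_scale_Pair scale_right_distrib scale_left_distrib algebra_simps)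
  then show ?thesis
    by (auto intro!: module_hom.intro module_hom_axioms.intro
        simp: ext_lift_Pair ext_scale_Pair h.add h.scale scale_right_distrib
          scale_left_distrib algebra_simps)
qed

text \<open>The decomposition \<open>(a, \<xi>) = \<iota> a + \<xi>\<sigma>\<close> leaves a linear extension no freedom outside \<open>\<sigma>\<close>.\<close>

lemma linear_extension_eq_ext_lift:
  fixes \<beta> :: "'r \<times> 'f \<Rightarrow> 'r \<times> 'f"
  assumes "module_hom (ext_scale smul) (ext_scale smul) \<beta>"
    and "\<beta> \<circ> ext_incl = ext_incl \<circ> \<alpha>"
  shows "\<beta> = ext_lift \<alpha> (fst (\<beta> (0, 1))) (snd (\<beta> (0, 1)))"
proof
  fix x :: "'r \<times> 'f"
  interpret h: module_hom "ext_scale smul" "ext_scale smul" \<beta> by fact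
  obtain a \<xi> where x: "x = (a, \<xi>)" by fastforce
  obtain w \<epsilon> where w: "\<beta> (0, 1) = (w, \<epsilon>)" by fastforce
  have "x = ext_incl a + ext_scale smul \<xi> (0, 1)"
    by (simp add: x ext_incl_def ext_scale_Pair)
  then have "\<beta> x = \<beta> (ext_incl a) + ext_scale smul \<xi> (\<beta> (0, 1))"
    by (simp only: h.add h.scale)
  also have "\<beta> (ext_incl a) = ext_incl (\<alpha> a)"
    using assms(2) by (simp add: fun_eq_iff)
  finally show "\<beta> x = ext_lift \<alpha> (fst (\<beta> (0, 1))) (snd (\<beta> (0, 1))) x"
    by (simp add: x w ext_incl_def ext_lift_Pair ext_scale_Pair)
qed

text \<open>
  The product of the extension is bilinear, so multiplicativity needs checking only on products of
  elements of \<open>R\<close>, where it holds because \<open>\<alpha>\<close> is multiplicative, and on the products \<open>\<sigma>\<sigma>\<close>,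
  \<open>a\<sigma>\<close>, \<open>\<sigma>a\<close>.  The first two conditions on the right are the two components of the one for \<open>\<sigma>\<sigma>\<close>.
\<close>

lemma ext_lift_multiplicative_iff:
  assumes datum: "homothetic_datum smul mult \<sigma> s"
    and endo: "algebra_endomorphism smul mult \<alpha>"
  shows "(\<forall>x y. ext_lift \<alpha> w \<epsilon> (ext_mult smul mult \<sigma> s x y)
              = ext_mult smul mult \<sigma> s (ext_lift \<alpha> w \<epsilon> x) (ext_lift \<alpha> w \<epsilon> y))
     \<longleftrightarrow> \<epsilon> * \<epsilon> = \<epsilon> \<and>
         \<alpha> s - smul \<epsilon> s = mult w w + smul \<epsilon> (w \<lhd> \<sigma>) + smul \<epsilon> (\<sigma> \<rhd> w) - w \<and>
         (\<forall>a. \<alpha> (a \<lhd> \<sigma>) = smul \<epsilon> (\<alpha> a \<lhd> \<sigma>) + mult (\<alpha> a) w) \<and>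
         (\<forall>a. \<alpha> (\<sigma> \<rhd> a) = smul \<epsilon> (\<sigma> \<rhd> \<alpha> a) + mult w (\<alpha> a))"
    (is "?multiplicative \<longleftrightarrow> ?relations")
proof -
  interpret h: module_hom smul smul \<alpha>
    using endo by (simp add: algebra_endomorphism_def)
  interpret r: module_hom smul smul "\<lambda>a. a \<lhd> \<sigma>"
    by (rule homothetic_datum_linear_actions[OF datum])
  interpret l: module_hom smul smul "\<lambda>a. \<sigma> \<rhd> a"
    by (rule homothetic_datum_linear_actions[OF datum])
  have \<alpha>_mult: "\<alpha> (mult a b) = mult (\<alpha> a) (\<alpha> b)" for a b
    using endo by (simp add: algebra_endomorphism_def)
  note pair = ext_mult_def ext_lift_Pair
  note lin = h.add h.scale r.add r.scale l.add l.scale mult_add_left mult_add_right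
    mult_scale_left mult_scale_right scale_right_distrib
  show ?thesis
  proof
    assume mul: ?multiplicative
    have "\<alpha> s + w = mult w w + smul \<epsilon> (w \<lhd> \<sigma>) + smul \<epsilon> (\<sigma> \<rhd> w) + smul (\<epsilon> * \<epsilon>) s"
      and idem: "\<epsilon> * \<epsilon> = \<epsilon>"
      using mul[rule_format, of "(0, 1)" "(0, 1)"]
      by (simp_all add: pair mult_zero_left mult_zero_right)
    then have "\<alpha> s - smul \<epsilon> s = mult w w + smul \<epsilon> (w \<lhd> \<sigma>) + smul \<epsilon> (\<sigma> \<rhd> w) - w"
      by (simp add: algebra_simps)
    moreover have "\<alpha> (a \<lhd> \<sigma>) = smul \<epsilon> (\<alpha> a \<lhd> \<sigma>) + mult (\<alpha> a) w" for a
      using mul[rule_format, of "(a, 0)" "(0, 1)"]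
      by (simp add: pair mult_zero_left mult_zero_right add.commute)
    moreover have "\<alpha> (\<sigma> \<rhd> a) = smul \<epsilon> (\<sigma> \<rhd> \<alpha> a) + mult w (\<alpha> a)" for a
      using mul[rule_format, of "(0, 1)" "(a, 0)"]
      by (simp add: pair mult_zero_left mult_zero_right add.commute)
    ultimately show ?relations
      using idem by blast
  next
    assume rel: ?relations
    then have idem: "\<epsilon> * \<epsilon> = \<epsilon>"
      and sq: "\<alpha> s = mult w w + smul \<epsilon> (w \<lhd> \<sigma>) + smul \<epsilon> (\<sigma> \<rhd> w) - w + smul \<epsilon> s"
      and right: "\<And>a. \<alpha> (a \<lhd> \<sigma>) = smul \<epsilon> (\<alpha> a \<lhd> \<sigma>) + mult (\<alpha> a) w"
      and left: "\<And>a. \<alpha> (\<sigma> \<rhd> a) = smul \<epsilon> (\<sigma> \<rhd> \<alpha> a) + mult w (\<alpha> a)"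
      by (auto simp: diff_eq_eq)
    have idem': "\<epsilon> * (\<epsilon> * \<zeta>) = \<epsilon> * \<zeta>" for \<zeta>
      using idem by (simp flip: mult.assoc)
    show ?multiplicative
    proof (intro allI)
      fix x y :: "'r \<times> 'f"
      obtain a \<xi> b \<zeta> where "x = (a, \<xi>)" "y = (b, \<zeta>)" by fastforce
      then show "ext_lift \<alpha> w \<epsilon> (ext_mult smul mult \<sigma> s x y)
          = ext_mult smul mult \<sigma> s (ext_lift \<alpha> w \<epsilon> x) (ext_lift \<alpha> w \<epsilon> y)"
        by (simp add: pair lin \<alpha>_mult sq right left scale_right_diff_distrib)
          (simp add: ac_simps idem idem')
    qed
  qed
qed

end

theorem proposition2p4:
  fixes smul :: "'f::field_or_int \<Rightarrow> 'r::ab_group_add \<Rightarrow> 'r"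
    and mult :: "'r \<Rightarrow> 'r \<Rightarrow> 'r"
    and \<sigma> :: "'r double_op" and s :: 'r
    and \<alpha>\<^sub>R :: "'r \<Rightarrow> 'r"
  assumes "assoc_algebra smul mult"
    and "homothetic_datum smul mult \<sigma> s"
    and "algebra_endomorphism smul mult \<alpha>\<^sub>R"
  shows "(\<exists>\<alpha>\<^sub>S :: 'r \<times> 'f \<Rightarrow> 'r \<times> 'f.
            algebra_endomorphism (ext_scale smul) (ext_mult smul mult \<sigma> s) \<alpha>\<^sub>S \<and>
            \<alpha>\<^sub>S \<circ> ext_incl = ext_incl \<circ> \<alpha>\<^sub>R)
     \<longleftrightarrow> (\<exists>(w :: 'r) (\<epsilon> :: 'f). (\<epsilon> = 0 \<or> \<epsilon> = 1) \<and>
           (\<forall>a.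
             \<alpha>\<^sub>R s - smul \<epsilon> s
               = mult w w + smul \<epsilon> (w \<lhd> \<sigma>) + smul \<epsilon> (\<sigma> \<rhd> w) - w \<and>
             \<alpha>\<^sub>R (a \<lhd> \<sigma>) = smul \<epsilon> (\<alpha>\<^sub>R a \<lhd> \<sigma>) + mult (\<alpha>\<^sub>R a) w \<and>
             \<alpha>\<^sub>R (\<sigma> \<rhd> a) = smul \<epsilon> (\<sigma> \<rhd> \<alpha>\<^sub>R a) + mult w (\<alpha>\<^sub>R a)))"
proof -
  interpret assoc_algebra smul mult by fact
  have hom: "module_hom smul smul \<alpha>\<^sub>R"
    using assms(3) by (simp add: algebra_endomorphism_def)
  note crit = ext_lift_multiplicative_iff[OF assms(2,3)]
  show ?thesis (is "?extends \<longleftrightarrow> ?relations")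
  proof
    assume ?extends
    then obtain \<alpha>\<^sub>S :: "'r \<times> 'f \<Rightarrow> 'r \<times> 'f"
      where endo: "algebra_endomorphism (ext_scale smul) (ext_mult smul mult \<sigma> s) \<alpha>\<^sub>S"
        and ext: "\<alpha>\<^sub>S \<circ> ext_incl = ext_incl \<circ> \<alpha>\<^sub>R"
      by blast
    define w where "w = fst (\<alpha>\<^sub>S (0, 1))"
    define \<epsilon> where "\<epsilon> = snd (\<alpha>\<^sub>S (0, 1))"
    have "\<alpha>\<^sub>S = ext_lift \<alpha>\<^sub>R w \<epsilon>"
      unfolding w_def \<epsilon>_def using endo ext
      by (intro linear_extension_eq_ext_lift) (simp_all add: algebra_endomorphism_def)
    with endo crit[of w \<epsilon>] show ?relations
      unfolding algebra_endomorphism_def idempotent_iff_zero_or_one by blast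
  next
    assume ?relations
    then obtain w and \<epsilon> :: 'f where "ext_lift \<alpha>\<^sub>R w \<epsilon> (ext_mult smul mult \<sigma> s x y)
        = ext_mult smul mult \<sigma> s (ext_lift \<alpha>\<^sub>R w \<epsilon> x) (ext_lift \<alpha>\<^sub>R w \<epsilon> y)" for x y
      using crit unfolding idempotent_iff_zero_or_one by blast
    then have "algebra_endomorphism (ext_scale smul) (ext_mult smul mult \<sigma> s) (ext_lift \<alpha>\<^sub>R w \<epsilon>)"
      using module_hom_ext_lift[OF hom] by (simp add: algebra_endomorphism_def)
    then show ?extends
      using ext_lift_extends by blast
  qed
qed

end
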